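(* Let $H_1\in\mathcal{H}$ and let $T\in\mathcal{H}$ be a tree. If $H_1\le T$, then $H_1$ is a tree.
   Context: All graphs are finite and simple, considered up to isomorphism. An edge-colored graph is a pair $(G,c)$ with $c\colon E(G)\to\mathbb{N}$ an arbitrary map (not necessarily proper); it is colored in $t$ or more colors if $|c(E(G))|\ge t$. A subgraph (not necessarily induced) is rainbow if its edges receive pairwise distinct colors. $(G,c)$ is rainbow $H$-free if $G$ contains no rainbow subgraph isomorphic to $H$. For graphs $H_1,H_2$, write $H_1\le H_2$ if there is a positive integer $t$ such that every rainbow $H_1$-free edge-colored complete graph colored in $t$ or more colors is rainbow $H_2$-free. $\mathcal{H}$ denotes the set of connected finite simple graphs other than the paths $P_1,P_2,P_3,P_4$ ($P_k$ is the path on $k$ vertices). *)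

theory Defs
  imports Main
begin

text \<open>Undirected graphs: an edge is the set of its two end vertices.\<close>

record 'a ugraph =
  vertices :: "'a set"
  edges :: "'a set set"

definition simple_graph :: "'a ugraph \<Rightarrow> bool" where
  "simple_graph G \<longleftrightarrow> finite (vertices G) \<and> (\<forall>e\<in>edges G. e \<subseteq> vertices G \<and> card e = 2)"

definition graph_iso :: "'a ugraph \<Rightarrow> 'b ugraph \<Rightarrow> bool" where
  "graph_iso G H \<longleftrightarrow>
     (\<exists>f. bij_betw f (vertices G) (vertices H) \<and> (\<lambda>e. f ` e) ` edges G = edges H)"

text \<open>Subgraphs need not be induced.\<close>

definition subgraph_of :: "'a ugraph \<Rightarrow> 'a ugraph \<Rightarrow> bool" where
  "subgraph_of S G \<longleftrightarrow>
     simple_graph S \<and> vertices S \<subseteq> vertices G \<and> edges S \<subseteq> edges G"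

definition complete_graph :: "'a ugraph \<Rightarrow> bool" where
  "complete_graph G \<longleftrightarrow>
     simple_graph G \<and> (\<forall>u\<in>vertices G. \<forall>v\<in>vertices G. u \<noteq> v \<longrightarrow> {u, v} \<in> edges G)"

text \<open>The graph without vertices is not connected.\<close>

definition connected_graph :: "'a ugraph \<Rightarrow> bool" where
  "connected_graph G \<longleftrightarrow> vertices G \<noteq> {} \<and>
     (\<forall>u\<in>vertices G. \<forall>v\<in>vertices G. (u, v) \<in> {(x, y). {x, y} \<in> edges G}\<^sup>*)"

text \<open>A cycle is given by the list of its vertices in cyclic order, without repeating
  the first vertex at the end.\<close>

definition graph_cycle :: "'a ugraph \<Rightarrow> 'a list \<Rightarrow> bool" where
  "graph_cycle G p \<longleftrightarrow> 3 \<le> length p \<and> distinct p \<and> set p \<subseteq> vertices G \<and>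
     (\<forall>i<length p. {p ! i, p ! (Suc i mod length p)} \<in> edges G)"

definition tree_graph :: "'a ugraph \<Rightarrow> bool" where
  "tree_graph G \<longleftrightarrow> simple_graph G \<and> connected_graph G \<and> \<not> (\<exists>p. graph_cycle G p)"

text \<open>The path on \<open>k\<close> (not on \<open>k + 1\<close>) vertices.\<close>

definition path_graph :: "nat \<Rightarrow> nat ugraph" where
  "path_graph k = \<lparr>vertices = {..<k}, edges = {{i, Suc i} | i. Suc i < k}\<rparr>"

definition graph_class_H :: "'a ugraph set" where
  "graph_class_H =
     {G. simple_graph G \<and> connected_graph G \<and> (\<forall>k\<in>{1..4}. \<not> graph_iso G (path_graph k))}"

text \<open>A colouring is a total function on sets of vertices; only its values on edges matter.\<close>

definition rainbow :: "('a set \<Rightarrow> nat) \<Rightarrow> 'a ugraph \<Rightarrow> bool" where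
  "rainbow c S \<longleftrightarrow> inj_on c (edges S)"

definition rainbow_free :: "'h ugraph \<Rightarrow> 'a ugraph \<Rightarrow> ('a set \<Rightarrow> nat) \<Rightarrow> bool" where
  "rainbow_free H G c \<longleftrightarrow> \<not> (\<exists>S. subgraph_of S G \<and> rainbow c S \<and> graph_iso S H)"

text \<open>Since all graphs are finite, complete graphs whose vertices are natural numbers
  represent every complete graph up to isomorphism.\<close>

definition rainbow_le :: "'a ugraph \<Rightarrow> 'b ugraph \<Rightarrow> bool" where
  "rainbow_le H1 H2 \<longleftrightarrow>
     (\<exists>t>0. \<forall>(G :: nat ugraph) c.
        complete_graph G \<and> t \<le> card (c ` edges G) \<and> rainbow_free H1 G c
          \<longrightarrow> rainbow_free H2 G c)"

end

theory Submission
  imports Defs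
begin

text \<open>Colour the edges of the complete graph on \<open>{..<n}\<close> by their smaller end vertex.
  No cycle is rainbow, since the two edges of a cycle at its least vertex have the same colour.
  On the other hand, a forest can be taken apart by removing vertices of degree at most one; if
  its vertices are numbered in this order, every vertex has at most one neighbour with a larger
  number, so the forest becomes rainbow. Hence if \<open>H\<^sub>1\<close> contains a cycle, these
  colourings are rainbow \<open>H\<^sub>1\<close>-free, use arbitrarily many colours, and contain
  every tree as a rainbow subgraph.\<close>

section \<open>Leaves and numberings of forests\<close>

text \<open>An end of a longest path qualifies: by maximality all its neighbours lie on the path,
  and a neighbour beyond the second vertex would close a cycle.\<close>

lemma exists_vertex_degree_le_1:
  assumes simple: "simple_graph G" and acyclic: "\<nexists>p. graph_cycle G p"
    and nonempty: "vertices G \<noteq> {}"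
  shows "\<exists>v\<in>vertices G. \<forall>e\<in>edges G. \<forall>e'\<in>edges G. v \<in> e \<longrightarrow> v \<in> e' \<longrightarrow> e = e'"
proof -
  \<comment> \<open>Despite its name, a \<open>walk\<close> is a path: no vertex repeats. Hence its
    length is bounded and a longest one exists.\<close>
  define walk where "walk p \<longleftrightarrow> p \<noteq> [] \<and> distinct p \<and> set p \<subseteq> vertices G \<and>
    (\<forall>i. Suc i < length p \<longrightarrow> {p ! i, p ! Suc i} \<in> edges G)" for p
  have fin: "finite (vertices G)"
    and edge: "\<And>e. e \<in> edges G \<Longrightarrow> e \<subseteq> vertices G \<and> card e = 2"
    using simple by (auto simp: simple_graph_def)
  obtain r where "r \<in> vertices G"
    using nonempty by blast
  then have "walk [r]"
    by (simp add: walk_def)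
  moreover have "\<forall>p. walk p \<longrightarrow> length p < Suc (card (vertices G))"
    by (metis walk_def fin card_mono distinct_card less_Suc_eq_le)
  ultimately have "\<exists>p. walk p \<and> (\<forall>q. walk q \<longrightarrow> length q \<le> length p)"
    by (rule ex_has_greatest_nat)
  then obtain p where p: "walk p" and longest: "\<And>q. walk q \<Longrightarrow> length q \<le> length p"
    by blast
  define v where "v = hd p"
  have v: "v \<in> vertices G" "p ! 0 = v"
    using p by (auto simp: walk_def v_def hd_conv_nth)
  have second: "1 < length p \<and> w = p ! 1" if e: "{v, w} \<in> edges G" for w
  proof -
    have w: "w \<in> vertices G" "w \<noteq> v"
      using edge[OF e] by auto
    have "w \<in> set p"
    proof (rule ccontr)
      assume "w \<notin> set p"
      \<comment> \<open>Prepending \<open>w\<close> would give a longer path.\<close>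
      have "walk (w # p)"
        unfolding walk_def
      proof (intro conjI allI impI)
        fix i assume "Suc i < length (w # p)"
        then show "{(w # p) ! i, (w # p) ! Suc i} \<in> edges G"
          using p e v by (cases i) (auto simp: walk_def insert_commute)
      qed (use p w \<open>w \<notin> set p\<close> in \<open>auto simp: walk_def\<close>)
      with longest show False
        by fastforce
    qed
    then obtain j where j: "j < length p" "w = p ! j"
      by (auto simp: in_set_conv_nth)
    have "j \<noteq> 0"
      using j v w by metis
    moreover have "\<not> 2 \<le> j"
    proof
      assume "2 \<le> j"
      \<comment> \<open>The initial segment of the path from \<open>v\<close> to \<open>w\<close>,
        closed up by the edge \<open>{v, w}\<close>; it has at least three vertices because
        \<open>2 \<le> j\<close>. In the cases below, \<open>i = j\<close> is this closing
        edge.\<close>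
      let ?q = "take (Suc j) p"
      have len: "length ?q = Suc j"
        using j by simp
      have "graph_cycle G ?q"
        unfolding graph_cycle_def
      proof (intro conjI allI impI)
        show "3 \<le> length ?q"
          using len \<open>2 \<le> j\<close> by simp
        show "distinct ?q"
          using p by (simp add: walk_def)
        show "set ?q \<subseteq> vertices G"
          using p set_take_subset by (fastforce simp: walk_def)
        fix i assume "i < length ?q"
        then consider "i < j" | "i = j"
          using len by linarith
        then show "{?q ! i, ?q ! (Suc i mod length ?q)} \<in> edges G"
        proof cases
          case 1
          then show ?thesis
            using p j unfolding len by (simp add: walk_def)
        next
          case 2
          then show ?thesis
            using e j v unfolding len by (simp add: insert_commute)
        qed
      qed
      with acyclic show False
        by blast
    qed
    ultimately show ?thesis
      using j by (cases "j = 1") auto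
  qed
  have "e = {v, p ! 1}" if e: "e \<in> edges G" "v \<in> e" for e
  proof -
    obtain w where "e = {v, w}"
      using edge[OF e(1)] e(2) by (auto simp: card_2_iff)
    with second e show ?thesis
      by blast
  qed
  then have "\<forall>e\<in>edges G. \<forall>e'\<in>edges G. v \<in> e \<longrightarrow> v \<in> e' \<longrightarrow> e = e'"
    by metis
  with v(1) show ?thesis
    by (rule rev_bexI)
qed

text \<open>Induction on the number of vertices, deleting a vertex of degree at most one.
  Injectivity of \<open>Min\<close> on the relabelled edges is what makes the copy of the forest
  rainbow.\<close>

lemma forest_numbering:
  assumes "simple_graph G" and "\<nexists>p. graph_cycle G p"
  shows "\<exists>f :: 'a \<Rightarrow> nat. inj_on f (vertices G) \<and> inj_on (\<lambda>e. Min (f ` e)) (edges G)"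
  using assms
proof (induction "card (vertices G)" arbitrary: G)
  case 0
  then have "edges G = {}"
    by (force simp: simple_graph_def)
  moreover have "vertices G = {}"
    using 0 by (auto simp: simple_graph_def)
  ultimately show ?case
    by simp
next
  case (Suc n G)
  have "vertices G \<noteq> {}"
    using Suc.hyps by force
  then obtain v where v: "v \<in> vertices G"
    and leaf: "\<And>e e'. \<lbrakk>e \<in> edges G; e' \<in> edges G; v \<in> e; v \<in> e'\<rbrakk> \<Longrightarrow> e = e'"
    using exists_vertex_degree_le_1[OF Suc.prems] by blast
  have edge: "\<And>e. e \<in> edges G \<Longrightarrow> e \<subseteq> vertices G \<and> card e = 2"
    using Suc.prems by (auto simp: simple_graph_def)
  define G' :: "'a ugraph"
    where "G' = \<lparr>vertices = vertices G - {v}, edges = {e \<in> edges G. v \<notin> e}\<rparr>"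
  have "simple_graph G'"
    using Suc.prems by (auto simp: simple_graph_def G'_def)
  moreover have "\<nexists>p. graph_cycle G' p"
    using Suc.prems by (fastforce simp: graph_cycle_def G'_def)
  moreover have "n = card (vertices G')"
    using Suc.hyps v by (simp add: G'_def)
  ultimately obtain f :: "'a \<Rightarrow> nat"
    where f: "inj_on f (vertices G')" "inj_on (\<lambda>e. Min (f ` e)) (edges G')"
    using Suc.hyps by blast
  \<comment> \<open>The deleted vertex takes the least number and all others move up by one. So
    edges at \<open>v\<close> get colour 0, and every other edge gets its old colour plus
    one.\<close>
  define g where "g x = (if x = v then 0 else Suc (f x))" for x
  have "inj_on g (vertices G)"
    using f(1) by (auto simp: inj_on_def g_def G'_def)
  moreover have "inj_on (\<lambda>e. Min (g ` e)) (edges G)"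
  proof (rule inj_onI)
    fix e e' assume e: "e \<in> edges G" "e' \<in> edges G" and eq: "Min (g ` e) = Min (g ` e')"
    have at_leaf: "Min (g ` d) = 0" if "d \<in> edges G" "v \<in> d" for d
    proof -
      have "finite d"
        using edge[OF that(1)] by (simp add: card_ge_0_finite)
      then have "Min (g ` d) \<le> g v"
        using that by simp
      then show ?thesis
        by (simp add: g_def)
    qed
    have off_leaf: "Min (g ` d) = Suc (Min (f ` d))" if "d \<in> edges G" "v \<notin> d" for d
    proof -
      have "finite d" "d \<noteq> {}"
        using edge[OF that(1)] by (auto simp: card_ge_0_finite)
      then have "Suc (Min (f ` d)) = Min (Suc ` f ` d)"
        by (intro mono_Min_commute) (auto simp: mono_def)
      moreover have "g ` d = Suc ` f ` d"
        using that(2) by (force simp: g_def image_image)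
      ultimately show ?thesis
        by simp
    qed
    show "e = e'"
    proof (cases "v \<in> e \<or> v \<in> e'")
      case True
      \<comment> \<open>Colour 0 occurs only at \<open>v\<close>, so if one of the two edges
        contains \<open>v\<close>, both do.\<close>
      then have "v \<in> e" "v \<in> e'"
        using e eq at_leaf off_leaf by (metis nat.distinct(1))+
      with e leaf show ?thesis
        by blast
    next
      case False
      then show ?thesis
        using e eq f(2) off_leaf by (auto simp: inj_on_def G'_def)
    qed
  qed
  ultimately show ?case
    by blast
qed

section \<open>Cycles under the colouring by \<open>Min\<close>\<close>

lemma graph_cycle_not_rainbow_Min:
  fixes G :: "nat ugraph"
  assumes "graph_cycle G p"
  shows "\<not> rainbow Min G"
proof
  assume rb: "rainbow Min G"
  let ?L = "length p"
  have L: "3 \<le> ?L" and dist: "distinct p"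
    and edge: "\<And>i. i < ?L \<Longrightarrow> {p ! i, p ! (Suc i mod ?L)} \<in> edges G"
    using assms by (auto simp: graph_cycle_def)
  have "p \<noteq> []"
    using L by auto
  then have "Min (set p) \<in> set p"
    by simp
  then obtain i where i: "i < ?L" "p ! i = Min (set p)"
    by (auto simp: in_set_conv_nth)
  have least: "Min {p ! i, p ! k} = p ! i" if "k < ?L" for k
    using that i by (auto simp: min_def)
  \<comment> \<open>The cyclic predecessor of \<open>i\<close>. It differs from the successor
    because the cycle has at least three vertices.\<close>
  define j where "j = (if i = 0 then ?L - 1 else i - 1)"
  have j: "j < ?L" "Suc j mod ?L = i"
    using i L by (auto simp: j_def)
  have next_i: "Suc i mod ?L = (if Suc i = ?L then 0 else Suc i)"
    using i by auto
  have k: "Suc i mod ?L < ?L" "Suc i mod ?L \<noteq> i" "Suc i mod ?L \<noteq> j"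
    using i L unfolding next_i by (auto simp: j_def)
  have "{p ! i, p ! j} \<in> edges G"
    using edge[OF j(1)] j(2) by (simp add: insert_commute)
  with edge[OF i(1)] have "{p ! i, p ! (Suc i mod ?L)} = {p ! i, p ! j}"
    using rb least[OF k(1)] least[OF j(1)] unfolding rainbow_def by (metis inj_onD)
  then have "p ! (Suc i mod ?L) \<in> {p ! i, p ! j}"
    by blast
  with dist i(1) j(1) k show False
    by (auto simp: nth_eq_iff_index_eq)
qed

section \<open>Invariance under isomorphism\<close>

text \<open>Simplicity keeps each edge inside \<open>vertices G\<close>, where
  \<open>inv_into\<close> undoes \<open>f\<close>; \<open>graph_iso\<close> alone does not tie edges
  to vertices.\<close>

lemma graph_iso_sym:
  assumes "graph_iso G H" and "simple_graph G"
  shows "graph_iso H G"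
proof -
  obtain f where f: "bij_betw f (vertices G) (vertices H)" "(\<lambda>e. f ` e) ` edges G = edges H"
    using assms by (auto simp: graph_iso_def)
  let ?g = "inv_into (vertices G) f"
  have "?g ` f ` e = e" if "e \<in> edges G" for e
    using f(1) assms(2) that
    by (intro inv_into_image_cancel) (auto simp: bij_betw_def simple_graph_def)
  then have "(\<lambda>e. ?g ` e) ` edges H = edges G"
    by (simp add: f(2)[symmetric] image_image)
  then show ?thesis
    unfolding graph_iso_def using bij_betw_inv_into[OF f(1)] by blast
qed

lemma graph_iso_cycle:
  assumes "graph_iso G H" and "graph_cycle G p"
  shows "\<exists>q. graph_cycle H q"
proof -
  obtain f where f: "bij_betw f (vertices G) (vertices H)" "(\<lambda>e. f ` e) ` edges G = edges H"
    using assms by (auto simp: graph_iso_def)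
  have p: "3 \<le> length p" "distinct p" "set p \<subseteq> vertices G"
    and edge: "\<And>i. i < length p \<Longrightarrow> {p ! i, p ! (Suc i mod length p)} \<in> edges G"
    using assms(2) by (auto simp: graph_cycle_def)
  have "graph_cycle H (map f p)"
    unfolding graph_cycle_def
  proof (intro conjI allI impI)
    show "distinct (map f p)"
      using p f(1) by (auto simp: distinct_map bij_betw_def intro: inj_on_subset)
    show "set (map f p) \<subseteq> vertices H"
      using p f(1) by (auto simp: bij_betw_def)
    fix i assume i: "i < length (map f p)"
    then have "Suc i mod length p < length p"
      by (intro mod_less_divisor) auto
    moreover have "f ` {p ! i, p ! (Suc i mod length p)} \<in> edges H"
      using f(2) edge i by (metis imageI length_map)
    ultimately show "{map f p ! i, map f p ! (Suc i mod length (map f p))} \<in> edges H"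
      using i by simp
  qed (use p in simp)
  then show ?thesis
    by blast
qed

section \<open>The coloured complete graphs\<close>

definition clique :: "nat \<Rightarrow> nat ugraph" where
  "clique n = \<lparr>vertices = {..<n}, edges = {e. e \<subseteq> {..<n} \<and> card e = 2}\<rparr>"

lemma complete_graph_clique: "complete_graph (clique n)"
  by (auto simp: complete_graph_def simple_graph_def clique_def)

text \<open>The edges from the largest vertex \<open>n\<close> to the vertices below it already show
  all the colours less than \<open>n\<close>.\<close>

lemma card_Min_edges_clique: "n \<le> card (Min ` edges (clique (Suc n)))"
proof -
  have "i \<in> Min ` edges (clique (Suc n))" if "i < n" for i
  proof
    show "i = Min {i, n}"
      using that by simp
    show "{i, n} \<in> edges (clique (Suc n))"
      using that by (auto simp: clique_def)
  qed
  then have "{..<n} \<subseteq> Min ` edges (clique (Suc n))"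
    by auto
  moreover have "finite (edges (clique (Suc n)))"
    by (simp add: clique_def)
  ultimately show ?thesis
    by (metis card_lessThan card_mono finite_imageI)
qed

lemma rainbow_free_clique_Min:
  assumes "graph_cycle H p" and "simple_graph H"
  shows "rainbow_free H (clique n) Min"
  unfolding rainbow_free_def
proof safe
  fix S assume S: "subgraph_of S (clique n)" "rainbow Min S" "graph_iso S H"
  then have "graph_iso H S"
    by (simp add: graph_iso_sym subgraph_of_def)
  with S(2) assms(1) show False
    using graph_iso_cycle graph_cycle_not_rainbow_Min by blast
qed

lemma forest_rainbow_in_clique_Min:
  assumes "simple_graph T" and "\<nexists>p. graph_cycle T p"
  shows "\<exists>m. \<forall>n\<ge>m. \<not> rainbow_free T (clique n) Min"
proof -
  obtain f :: "'a \<Rightarrow> nat"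
    where f: "inj_on f (vertices T)" "inj_on (\<lambda>e. Min (f ` e)) (edges T)"
    using forest_numbering[OF assms] by blast
  have fin: "finite (vertices T)"
    and edge: "\<And>e. e \<in> edges T \<Longrightarrow> e \<subseteq> vertices T \<and> card e = 2"
    using assms by (auto simp: simple_graph_def)
  \<comment> \<open>All labels lie below \<open>m\<close>, so the relabelled forest fits into every
    clique on at least \<open>m\<close> vertices.\<close>
  obtain m where m: "f ` vertices T \<subseteq> {..<m}"
    using finite_nat_set_iff_bounded[of "f ` vertices T"] fin by auto
  define S where "S = \<lparr>vertices = f ` vertices T, edges = (\<lambda>e. f ` e) ` edges T\<rparr>"
  have card_edge: "card (f ` e) = 2" if "e \<in> edges T" for e
    using edge[OF that] f(1) by (metis card_image inj_on_subset)
  have simple: "simple_graph S"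
    using fin edge card_edge by (auto simp: simple_graph_def S_def)
  have "graph_iso T S"
    unfolding graph_iso_def S_def using f(1) by (auto simp: bij_betw_def)
  then have "graph_iso S T"
    using assms(1) by (rule graph_iso_sym)
  moreover have "rainbow Min S"
    unfolding rainbow_def S_def using f(2) by (auto simp: inj_on_def)
  moreover have "subgraph_of S (clique n)" if "m \<le> n" for n
  proof -
    have "vertices S \<subseteq> {..<n}"
      using m that by (force simp: S_def)
    then show ?thesis
      using simple by (auto simp: subgraph_of_def clique_def simple_graph_def)
  qed
  ultimately show ?thesis
    unfolding rainbow_free_def by blast
qed

theorem theorem3:
  fixes H1 :: "'a ugraph" and T :: "'b ugraph"
  assumes "H1 \<in> graph_class_H"
    and "T \<in> graph_class_H"
    and "tree_graph T"
    and "rainbow_le H1 T"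
  shows "tree_graph H1"
proof (rule ccontr)
  assume "\<not> tree_graph H1"
  with assms(1) obtain p where p: "graph_cycle H1 p" and H1: "simple_graph H1"
    by (auto simp: graph_class_H_def tree_graph_def)
  obtain t where t: "\<And>(G :: nat ugraph) c. \<lbrakk>complete_graph G; t \<le> card (c ` edges G);
      rainbow_free H1 G c\<rbrakk> \<Longrightarrow> rainbow_free T G c"
    using assms(4) unfolding rainbow_le_def by blast
  obtain m where m: "\<And>n. m \<le> n \<Longrightarrow> \<not> rainbow_free T (clique n) Min"
    using forest_rainbow_in_clique_Min assms(3) unfolding tree_graph_def by blast
  \<comment> \<open>Large enough for both demands: at least \<open>t\<close> colours, and room for a
    rainbow copy of \<open>T\<close>.\<close>
  let ?G = "clique (Suc (max t m))"
  have "t \<le> card (Min ` edges ?G)"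
    using card_Min_edges_clique[of "max t m"] by linarith
  then have "rainbow_free T ?G Min"
    using t complete_graph_clique rainbow_free_clique_Min[OF p H1] by blast
  with m show False
    by simp
qed

end
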